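(* Let $\Delta t>0$, $n\ge 0$, and let $\phi^{n+1},\mu^{n+\frac12},\widetilde R^{n+1}$ be produced from $\phi^n,\phi^{n-1},R^n$ by Step I of the EOP-SAV/CN scheme described in the context. Then the Step II update $$R^{n+1}=\min\left\{s^{n+1},\sqrt{\mathcal{E}_1(\phi^{n+1})}\right\},\qquad s^{n+1}=\sqrt{\tfrac12(\mathcal L\phi^{n},\phi^{n})-\tfrac12(\mathcal L\phi^{n+1},\phi^{n+1})+|R^{n}|^2},$$ is the optimal choice for modifying the energy dissipative law of the SAV method, in the following sense: $R=R^{n+1}$ satisfies the dissipation inequality $$\tfrac12(\mathcal L\phi^{n+1},\phi^{n+1})+R^2\le \tfrac12(\mathcal L\phi^{n},\phi^{n})+|R^{n}|^2, \qquad ( * )$$ and for every real number $R$ satisfying $( * )$ one has $$\left||R^{n+1}|^2-\mathcal E_1(\phi^{n+1})\right|\le \left|R^2-\mathcal E_1(\phi^{n+1})\right| .$$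
   Context: Setting: $\Omega$ is the spatial domain and $(\cdot,\cdot)$ is the $L^2(\Omega)$ inner product. The free energy is $E(\phi)=\frac12(\phi,\mathcal L\phi)+E_1(\phi)$ with $E_1(\phi)=\int_\Omega F(\phi)\,d\mathbf x$, where $\mathcal L$ is a symmetric non-negative linear operator and $F$ is a differentiable energy density with derivative $F'$. The gradient flow is $\partial_t\phi=-\mathcal G\mu$, $\mu=\mathcal L\phi+F'(\phi)$, with $\mathcal G$ a positive linear operator (so $(\mathcal G\mu,\mu)\ge0$). It is assumed that $E_1$ is bounded below: $E_1(\phi)>-C$ for all $\phi$, for a constant $C>0$. Put $\mathcal E_1(\phi)=E_1(\phi)+C>0$. EOP-SAV/CN scheme: set $\phi^0=\phi_0$, $R^0=\sqrt{E_1(\phi_0)+C}$ ($\phi^{-1}$ is a given starting value used only in the extrapolation at $n=0$). For $n\ge0$, with $\widehat\phi^{n+\frac12}=\frac32\phi^n-\frac12\phi^{n-1}$: Step I: $\phi^{n+1},\mu^{n+\frac12},\widetilde R^{n+1}$ (with $\widetilde R^{n+1}\in\mathbb R$) solve $$\frac{\phi^{n+1}-\phi^n}{\Delta t}=-\mathcal G\mu^{n+\frac12},$$ $$\mu^{n+\frac12}=\tfrac12\mathcal L\phi^{n+1}+\tfrac12\mathcal L\phi^n+\frac{\widetilde R^{n+1}+R^n}{2\sqrt{\mathcal E_1(\widehat\phi^{n+\frac12})}}F'(\widehat\phi^{n+\frac12}),$$ $$\frac{\widetilde R^{n+1}-R^n}{\Delta t}=\frac{1}{2\sqrt{\mathcal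 E_1(\widehat\phi^{n+\frac12})}}\left(F'(\widehat\phi^{n+\frac12}),\frac{\phi^{n+1}-\phi^n}{\Delta t}\right).$$ Step II: $R^{n+1}=\min\{s^{n+1},\sqrt{\mathcal E_1(\phi^{n+1})}\}$ with $s^{n+1}=\sqrt{\frac12(\mathcal L\phi^{n},\phi^{n})-\frac12(\mathcal L\phi^{n+1},\phi^{n+1})+|R^{n}|^2}$ (the radicand is non-negative for solutions of Step I). The functions $\phi^n,\mu^{n+\frac12}$ are assumed regular enough that all expressions make sense. *)

theory Defs
  imports "HOL-Analysis.Analysis"
begin

text \<open>Elements of \<open>L\<^sup>2(\<Omega>)\<close> are represented by functions on the ambient Euclidean space;
  only their values on \<open>\<Omega>\<close> matter, and equality in \<open>L\<^sup>2(\<Omega>)\<close> is equality almost everywhere on \<open>\<Omega>\<close>.\<close>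

definition L2_space :: "'a::euclidean_space set \<Rightarrow> ('a \<Rightarrow> real) set" where
  "L2_space \<Omega> = {f \<in> borel_measurable (lebesgue_on \<Omega>). integrable (lebesgue_on \<Omega>) (\<lambda>x. (f x)\<^sup>2)}"

definition L2_inner :: "'a::euclidean_space set \<Rightarrow> ('a \<Rightarrow> real) \<Rightarrow> ('a \<Rightarrow> real) \<Rightarrow> real" where
  "L2_inner \<Omega> f g = integral\<^sup>L (lebesgue_on \<Omega>) (\<lambda>x. f x * g x)"

text \<open>A possibly unbounded linear operator \<open>A\<close> in \<open>L\<^sup>2(\<Omega>)\<close> with domain \<open>D\<close>. The domain need not be
  closed under almost everywhere equality, so it may consist of distinguished (for instance smooth)
  representatives.\<close>

locale L2_operator =
  fixes \<Omega> :: "'a::euclidean_space set"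
    and D :: "('a \<Rightarrow> real) set"
    and A :: "('a \<Rightarrow> real) \<Rightarrow> 'a \<Rightarrow> real"
  assumes dom_L2: "D \<subseteq> L2_space \<Omega>"
    and dom_zero: "(\<lambda>x. 0) \<in> D"
    and dom_add: "f \<in> D \<Longrightarrow> g \<in> D \<Longrightarrow> (\<lambda>x. f x + g x) \<in> D"
    and dom_scale: "f \<in> D \<Longrightarrow> (\<lambda>x. c * f x) \<in> D"
    and maps_to_L2: "f \<in> D \<Longrightarrow> A f \<in> L2_space \<Omega>"
    and well_defined: "f \<in> D \<Longrightarrow> g \<in> D \<Longrightarrow> (AE x in lebesgue_on \<Omega>. f x = g x) \<Longrightarrow>
          (AE x in lebesgue_on \<Omega>. A f x = A g x)"
    and additive: "f \<in> D \<Longrightarrow> g \<in> D \<Longrightarrow>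
          (AE x in lebesgue_on \<Omega>. A (\<lambda>y. f y + g y) x = A f x + A g x)"
    and homogeneous: "f \<in> D \<Longrightarrow> (AE x in lebesgue_on \<Omega>. A (\<lambda>y. c * f y) x = c * A f x)"

definition energy1 :: "'a::euclidean_space set \<Rightarrow> (real \<Rightarrow> real) \<Rightarrow> ('a \<Rightarrow> real) \<Rightarrow> real" where
  "energy1 \<Omega> F \<phi> = integral\<^sup>L (lebesgue_on \<Omega>) (\<lambda>x. F (\<phi> x))"

definition shifted_energy1 ::
  "'a::euclidean_space set \<Rightarrow> (real \<Rightarrow> real) \<Rightarrow> real \<Rightarrow> ('a \<Rightarrow> real) \<Rightarrow> real" where
  "shifted_energy1 \<Omega> F C \<phi> = energy1 \<Omega> F \<phi> + C"

text \<open>The fields with a well-defined free energy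
  \<open>E(\<phi>) = 1/2 (\<phi>, \<L> \<phi>) + E\<^sub>1(\<phi>)\<close>, where \<open>D\<close> is the domain of \<open>\<L>\<close>.\<close>

definition finite_energy ::
  "'a::euclidean_space set \<Rightarrow> ('a \<Rightarrow> real) set \<Rightarrow> (real \<Rightarrow> real) \<Rightarrow> ('a \<Rightarrow> real) set" where
  "finite_energy \<Omega> D F = {\<phi> \<in> D. integrable (lebesgue_on \<Omega>) (\<lambda>x. F (\<phi> x))}"

locale gradient_flow =
  L: L2_operator \<Omega> D\<^sub>L \<L> + G: L2_operator \<Omega> D\<^sub>G \<G>
  for \<Omega> :: "'a::euclidean_space set"
    and D\<^sub>L :: "('a \<Rightarrow> real) set" and \<L> :: "('a \<Rightarrow> real) \<Rightarrow> 'a \<Rightarrow> real"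
    and D\<^sub>G :: "('a \<Rightarrow> real) set" and \<G> :: "('a \<Rightarrow> real) \<Rightarrow> 'a \<Rightarrow> real" +
  fixes F F' :: "real \<Rightarrow> real" and C :: real
  assumes domain: "open \<Omega>" "connected \<Omega>" "\<Omega> \<noteq> {}"
    and L_symmetric: "f \<in> D\<^sub>L \<Longrightarrow> g \<in> D\<^sub>L \<Longrightarrow> L2_inner \<Omega> (\<L> f) g = L2_inner \<Omega> f (\<L> g)"
    and L_nonneg: "f \<in> D\<^sub>L \<Longrightarrow> 0 \<le> L2_inner \<Omega> (\<L> f) f"
    and G_positive: "f \<in> D\<^sub>G \<Longrightarrow> 0 \<le> L2_inner \<Omega> (\<G> f) f"
    and F_derivative: "(F has_real_derivative F' u) (at u)"
    and C_pos: "0 < C"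
    and energy1_bounded_below: "\<phi> \<in> finite_energy \<Omega> D\<^sub>L F \<Longrightarrow> - C < energy1 \<Omega> F \<phi>"

text \<open>In the following definitions \<open>\<phi>p\<close>, \<open>\<phi>\<close>, \<open>\<phi>s\<close> stand for \<open>\<phi>\<close> at the levels \<open>n - 1\<close>, \<open>n\<close>,
  \<open>n + 1\<close>, and \<open>\<mu>\<close> for the value at \<open>n + 1/2\<close>.\<close>

definition extrapolate :: "('a \<Rightarrow> real) \<Rightarrow> ('a \<Rightarrow> real) \<Rightarrow> 'a \<Rightarrow> real" where
  "extrapolate \<phi> \<phi>p = (\<lambda>x. 3/2 * \<phi> x - 1/2 * \<phi>p x)"

text \<open>The regularity under which every expression of one step of the scheme makes sense.\<close>

definition eop_sav_regular ::
  "'a::euclidean_space set \<Rightarrow> ('a \<Rightarrow> real) set \<Rightarrow> ('a \<Rightarrow> real) set \<Rightarrow>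
   (real \<Rightarrow> real) \<Rightarrow> (real \<Rightarrow> real) \<Rightarrow>
   ('a \<Rightarrow> real) \<Rightarrow> ('a \<Rightarrow> real) \<Rightarrow> ('a \<Rightarrow> real) \<Rightarrow> ('a \<Rightarrow> real) \<Rightarrow> bool" where
  "eop_sav_regular \<Omega> D\<^sub>L D\<^sub>G F F' \<phi>p \<phi> \<phi>s \<mu> \<longleftrightarrow>
     \<phi>p \<in> D\<^sub>L \<and> \<phi> \<in> D\<^sub>L \<and> \<mu> \<in> D\<^sub>G \<and>
     \<phi>s \<in> finite_energy \<Omega> D\<^sub>L F \<and>
     extrapolate \<phi> \<phi>p \<in> finite_energy \<Omega> D\<^sub>L F \<and>
     (\<lambda>x. F' (extrapolate \<phi> \<phi>p x)) \<in> L2_space \<Omega>"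

definition eop_sav_step_I ::
  "'a::euclidean_space set \<Rightarrow> (('a \<Rightarrow> real) \<Rightarrow> 'a \<Rightarrow> real) \<Rightarrow> (('a \<Rightarrow> real) \<Rightarrow> 'a \<Rightarrow> real) \<Rightarrow>
   (real \<Rightarrow> real) \<Rightarrow> (real \<Rightarrow> real) \<Rightarrow> real \<Rightarrow> real \<Rightarrow>
   ('a \<Rightarrow> real) \<Rightarrow> ('a \<Rightarrow> real) \<Rightarrow> real \<Rightarrow> ('a \<Rightarrow> real) \<Rightarrow> ('a \<Rightarrow> real) \<Rightarrow> real \<Rightarrow> bool" where
  "eop_sav_step_I \<Omega> \<L> \<G> F F' C \<Delta>t \<phi>p \<phi> R \<phi>s \<mu> Rt \<longleftrightarrow>
     (let \<phi>h = extrapolate \<phi> \<phi>p; r = sqrt (shifted_energy1 \<Omega> F C \<phi>h) in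
       (AE x in lebesgue_on \<Omega>. (\<phi>s x - \<phi> x) / \<Delta>t = - \<G> \<mu> x) \<and>
       (AE x in lebesgue_on \<Omega>.
          \<mu> x = 1/2 * \<L> \<phi>s x + 1/2 * \<L> \<phi> x + (Rt + R) / (2 * r) * F' (\<phi>h x)) \<and>
       (Rt - R) / \<Delta>t =
         1 / (2 * r) * L2_inner \<Omega> (\<lambda>x. F' (\<phi>h x)) (\<lambda>x. (\<phi>s x - \<phi> x) / \<Delta>t))"

text \<open>Note that \<^const>\<open>sqrt\<close> is odd on negative arguments; for solutions of the first step the
  radicand below is non-negative.\<close>

definition eop_sav_s ::
  "'a::euclidean_space set \<Rightarrow> (('a \<Rightarrow> real) \<Rightarrow> 'a \<Rightarrow> real) \<Rightarrow>
   ('a \<Rightarrow> real) \<Rightarrow> real \<Rightarrow> ('a \<Rightarrow> real) \<Rightarrow> real" where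
  "eop_sav_s \<Omega> \<L> \<phi> R \<phi>s =
     sqrt (1/2 * L2_inner \<Omega> (\<L> \<phi>) \<phi> - 1/2 * L2_inner \<Omega> (\<L> \<phi>s) \<phi>s + \<bar>R\<bar>\<^sup>2)"

definition eop_sav_step_II ::
  "'a::euclidean_space set \<Rightarrow> (('a \<Rightarrow> real) \<Rightarrow> 'a \<Rightarrow> real) \<Rightarrow> (real \<Rightarrow> real) \<Rightarrow> real \<Rightarrow>
   ('a \<Rightarrow> real) \<Rightarrow> real \<Rightarrow> ('a \<Rightarrow> real) \<Rightarrow> real" where
  "eop_sav_step_II \<Omega> \<L> F C \<phi> R \<phi>s =
     min (eop_sav_s \<Omega> \<L> \<phi> R \<phi>s) (sqrt (shifted_energy1 \<Omega> F C \<phi>s))"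

end

theory Submission imports Defs begin

text \<open>
  Testing the first equation of Step I with \<open>\<mu>\<close>, the second with \<open>\<phi>s - \<phi>\<close> and multiplying the third by
  \<open>Rt + R\<close> shows that \<open>R' = Rt\<close> satisfies the dissipation inequality. Hence the radicand of
  \<open>s\<close> is at least \<open>Rt\<^sup>2\<close>, so it is non-negative, and the inequality says precisely
  \<open>R'\<^sup>2 \<le> s\<^sup>2\<close>. As \<open>\<E>\<^sub>1\<close> is positive, the squared Step II update is \<open>min (s\<^sup>2) \<E>\<^sub>1\<close>, which
  is the point of the interval \<open>[0, s\<^sup>2]\<close> closest to \<open>\<E>\<^sub>1\<close>.
\<close>

text \<open>The product is dominated through
  \<open>2 * \<bar>u * v\<bar> \<le> u\<^sup>2 + v\<^sup>2\<close>. Splitting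
  \<open>L2_inner\<close> over a sum or difference rests on this integrability.\<close>

lemma integrable_mult_L2_space:
  assumes "f \<in> L2_space \<Omega>" "g \<in> L2_space \<Omega>"
  shows "integrable (lebesgue_on \<Omega>) (\<lambda>x. f x * g x)"
proof (rule Bochner_Integration.integrable_bound)
  show "integrable (lebesgue_on \<Omega>) (\<lambda>x. (f x)\<^sup>2 + (g x)\<^sup>2)"
    using assms by (auto simp: L2_space_def)
  show "(\<lambda>x. f x * g x) \<in> borel_measurable (lebesgue_on \<Omega>)"
    using assms by (auto simp: L2_space_def)
  have "\<bar>u * v\<bar> \<le> u\<^sup>2 + v\<^sup>2" for u v :: real
  proof -
    have "2 * \<bar>u * v\<bar> \<le> u\<^sup>2 + v\<^sup>2"
      using zero_le_power2[of "\<bar>u\<bar> - \<bar>v\<bar>"] by (simp add: power2_diff abs_mult)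
    then show ?thesis
      using abs_ge_zero[of "u * v"] by linarith
  qed
  then show "AE x in lebesgue_on \<Omega>. norm (f x * g x) \<le> norm ((f x)\<^sup>2 + (g x)\<^sup>2)"
    by simp
qed

lemma L2_inner_commute: "L2_inner \<Omega> f g = L2_inner \<Omega> g f"
  by (simp add: L2_inner_def mult.commute)

lemma L2_inner_diff_right:
  assumes "f \<in> L2_space \<Omega>" "g \<in> L2_space \<Omega>" "h \<in> L2_space \<Omega>"
  shows "L2_inner \<Omega> f (\<lambda>x. g x - h x) = L2_inner \<Omega> f g - L2_inner \<Omega> f h"
  using assms by (simp add: L2_inner_def right_diff_distrib integrable_mult_L2_space)

lemma L2_space_diff:
  assumes "f \<in> L2_space \<Omega>" "g \<in> L2_space \<Omega>"
  shows "(\<lambda>x. f x - g x) \<in> L2_space \<Omega>"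
  using assms integrable_mult_L2_space[OF assms]
  by (auto simp: L2_space_def power2_diff mult.assoc)

text \<open>The energy law of the underlying SAV step: \<open>L2_inner \<Omega> \<mu> d\<close> is
  evaluated twice, once for its sign and once as the change of the modified energy.\<close>

lemma eop_sav_step_I_dissipation:
  assumes gf: "gradient_flow \<Omega> D\<^sub>L \<L> D\<^sub>G \<G> F F' C"
    and "0 < \<Delta>t"
    and reg: "eop_sav_regular \<Omega> D\<^sub>L D\<^sub>G F F' \<phi>p \<phi> \<phi>s \<mu>"
    and step: "eop_sav_step_I \<Omega> \<L> \<G> F F' C \<Delta>t \<phi>p \<phi> R \<phi>s \<mu> Rt"
  shows "1/2 * L2_inner \<Omega> (\<L> \<phi>s) \<phi>s + Rt\<^sup>2 \<le> 1/2 * L2_inner \<Omega> (\<L> \<phi>) \<phi> + R\<^sup>2"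
proof -
  interpret gradient_flow \<Omega> D\<^sub>L \<L> D\<^sub>G \<G> F F' C by (rule gf)
  define f where "f = (\<lambda>x. F' (extrapolate \<phi> \<phi>p x))"
  define r where "r = sqrt (shifted_energy1 \<Omega> F C (extrapolate \<phi> \<phi>p))"
  define d where "d = (\<lambda>x. \<phi>s x - \<phi> x)"
  define \<kappa> where "\<kappa> = (Rt + R) / (2 * r)"
  have D: "\<phi> \<in> D\<^sub>L" "\<phi>s \<in> D\<^sub>L" "\<mu> \<in> D\<^sub>G" and f: "f \<in> L2_space \<Omega>"
    using reg by (auto simp: eop_sav_regular_def finite_energy_def f_def)
  then have L2: "\<phi> \<in> L2_space \<Omega>" "\<phi>s \<in> L2_space \<Omega>" "\<mu> \<in> L2_space \<Omega>"
      "\<L> \<phi> \<in> L2_space \<Omega>" "\<L> \<phi>s \<in> L2_space \<Omega>" "\<G> \<mu> \<in> L2_space \<Omega>"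
    using L.dom_L2 G.dom_L2 L.maps_to_L2 G.maps_to_L2 by auto
  then have d: "d \<in> L2_space \<Omega>"
    unfolding d_def by (intro L2_space_diff)
  note int = integrable_mult_L2_space
  have flow: "AE x in lebesgue_on \<Omega>. d x / \<Delta>t = - \<G> \<mu> x"
    and pot: "AE x in lebesgue_on \<Omega>. \<mu> x = 1/2 * \<L> \<phi>s x + 1/2 * \<L> \<phi> x + \<kappa> * f x"
    and aux: "(Rt - R) / \<Delta>t = 1 / (2 * r) * L2_inner \<Omega> f (\<lambda>x. d x / \<Delta>t)"
    using step by (simp_all add: eop_sav_step_I_def Let_def f_def r_def d_def \<kappa>_def)
  \<comment> \<open>First evaluation: the flow equation replaces \<open>d\<close> by
    \<open>- \<Delta>t\<close> times \<open>\<G> \<mu>\<close> almost everywhere, so positivity of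
    \<open>\<G>\<close> fixes the sign.\<close>
  have "L2_inner \<Omega> \<mu> d = integral\<^sup>L (lebesgue_on \<Omega>) (\<lambda>x. - \<Delta>t * (\<G> \<mu> x * \<mu> x))"
    unfolding L2_inner_def
  proof (rule integral_cong_AE)
    show "AE x in lebesgue_on \<Omega>. \<mu> x * d x = - \<Delta>t * (\<G> \<mu> x * \<mu> x)"
      using flow by eventually_elim (use \<open>0 < \<Delta>t\<close> in \<open>simp add: divide_eq_eq\<close>)
  qed (use L2 d in \<open>auto simp: L2_space_def\<close>)
  also have "\<dots> = - \<Delta>t * L2_inner \<Omega> (\<G> \<mu>) \<mu>"
    by (simp add: L2_inner_def)
  also have "\<dots> \<le> 0"
    using G_positive[OF D(3)] \<open>0 < \<Delta>t\<close> by simp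
  finally have nonpos: "L2_inner \<Omega> \<mu> d \<le> 0" .
  \<comment> \<open>Second evaluation: the formula for the chemical potential is inserted
    instead.\<close>
  have "L2_inner \<Omega> \<mu> d = integral\<^sup>L (lebesgue_on \<Omega>)
      (\<lambda>x. 1/2 * (\<L> \<phi>s x * d x) + 1/2 * (\<L> \<phi> x * d x) + \<kappa> * (f x * d x))"
    unfolding L2_inner_def
  proof (rule integral_cong_AE)
    show "AE x in lebesgue_on \<Omega>.
        \<mu> x * d x = 1/2 * (\<L> \<phi>s x * d x) + 1/2 * (\<L> \<phi> x * d x) + \<kappa> * (f x * d x)"
      using pot by eventually_elim (simp add: algebra_simps)
  qed (use L2 d f in \<open>auto simp: L2_space_def\<close>)
  also have "\<dots> = 1/2 * L2_inner \<Omega> (\<L> \<phi>s) d + 1/2 * L2_inner \<Omega> (\<L> \<phi>) d + \<kappa> * L2_inner \<Omega> f d"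
    using L2 d f by (simp add: L2_inner_def int)
  \<comment> \<open>The factor \<open>1 / (2 * r)\<close> inside \<open>\<kappa>\<close> is the one
    in the equation for \<open>Rt\<close>, so the nonlinear term becomes a difference of
    squares.\<close>
  also have "\<kappa> * L2_inner \<Omega> f d = (Rt + R) * (Rt - R)"
  proof -
    have "(Rt - R) / \<Delta>t = L2_inner \<Omega> f d / (2 * r) / \<Delta>t"
      using aux by (simp add: L2_inner_def)
    then have "Rt - R = L2_inner \<Omega> f d / (2 * r)"
      using \<open>0 < \<Delta>t\<close> by (simp only: divide_cancel_right) simp
    then show ?thesis
      by (simp add: \<kappa>_def)
  qed
  also have "L2_inner \<Omega> (\<L> \<phi>s) d = L2_inner \<Omega> (\<L> \<phi>s) \<phi>s - L2_inner \<Omega> (\<L> \<phi>s) \<phi>"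
    unfolding d_def by (rule L2_inner_diff_right) (use L2 in auto)
  also have "L2_inner \<Omega> (\<L> \<phi>) d = L2_inner \<Omega> (\<L> \<phi>) \<phi>s - L2_inner \<Omega> (\<L> \<phi>) \<phi>"
    unfolding d_def by (rule L2_inner_diff_right) (use L2 in auto)
  \<comment> \<open>By symmetry of \<open>\<L>\<close> the mixed terms cancel, leaving half the
    difference of the two quadratic forms.\<close>
  also have "L2_inner \<Omega> (\<L> \<phi>) \<phi>s = L2_inner \<Omega> (\<L> \<phi>s) \<phi>"
    using L_symmetric[OF D(1) D(2)] by (simp add: L2_inner_commute)
  finally show ?thesis
    using nonpos by (simp add: algebra_simps power2_eq_square)
qed

lemma power2_min_sqrt:
  assumes "0 \<le> a" "0 \<le> b"
  shows "(min (sqrt a) (sqrt b))\<^sup>2 = min a b"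
  using assms by (simp add: min_def)

theorem theorem3p1:
  fixes \<Omega> :: "'a::euclidean_space set"
    and D\<^sub>L D\<^sub>G :: "('a \<Rightarrow> real) set"
    and \<L> \<G> :: "('a \<Rightarrow> real) \<Rightarrow> 'a \<Rightarrow> real"
    and F F' :: "real \<Rightarrow> real"
    and C \<Delta>t :: real
    and \<phi> \<mu> :: "int \<Rightarrow> 'a \<Rightarrow> real"  (* \<mu> k is the value at the half level k + 1/2 *)
    and Rt R :: "int \<Rightarrow> real"
    and n :: int
  assumes "gradient_flow \<Omega> D\<^sub>L \<L> D\<^sub>G \<G> F F' C"
    and "0 < \<Delta>t" and "0 \<le> n"
    and "eop_sav_regular \<Omega> D\<^sub>L D\<^sub>G F F' (\<phi> (n - 1)) (\<phi> n) (\<phi> (n + 1)) (\<mu> n)"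
    and "eop_sav_step_I \<Omega> \<L> \<G> F F' C \<Delta>t (\<phi> (n - 1)) (\<phi> n) (R n) (\<phi> (n + 1)) (\<mu> n) (Rt (n + 1))"
    and "R (n + 1) = eop_sav_step_II \<Omega> \<L> F C (\<phi> n) (R n) (\<phi> (n + 1))"
  shows "1/2 * L2_inner \<Omega> (\<L> (\<phi> (n + 1))) (\<phi> (n + 1)) + (R (n + 1))\<^sup>2
           \<le> 1/2 * L2_inner \<Omega> (\<L> (\<phi> n)) (\<phi> n) + \<bar>R n\<bar>\<^sup>2 \<and>
         (\<forall>R' :: real.
           1/2 * L2_inner \<Omega> (\<L> (\<phi> (n + 1))) (\<phi> (n + 1)) + R'\<^sup>2
             \<le> 1/2 * L2_inner \<Omega> (\<L> (\<phi> n)) (\<phi> n) + \<bar>R n\<bar>\<^sup>2 \<longrightarrow>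
           \<bar>\<bar>R (n + 1)\<bar>\<^sup>2 - shifted_energy1 \<Omega> F C (\<phi> (n + 1))\<bar>
             \<le> \<bar>R'\<^sup>2 - shifted_energy1 \<Omega> F C (\<phi> (n + 1))\<bar>)"
proof -
  let ?a = "L2_inner \<Omega> (\<L> (\<phi> n)) (\<phi> n)"
    and ?b = "L2_inner \<Omega> (\<L> (\<phi> (n + 1))) (\<phi> (n + 1))"
    and ?E = "shifted_energy1 \<Omega> F C (\<phi> (n + 1))"
  define Q where "Q = 1/2 * ?a - 1/2 * ?b + \<bar>R n\<bar>\<^sup>2"
  have "(Rt (n + 1))\<^sup>2 \<le> Q"
    using eop_sav_step_I_dissipation[OF assms(1,2,4,5)] by (simp add: Q_def)
  \<comment> \<open>Since \<open>sqrt\<close> is odd, only a non-negative \<open>Q\<close> makes the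
    square of \<open>sqrt Q\<close> equal to \<open>Q\<close>.\<close>
  then have "0 \<le> Q"
    using zero_le_power2 order_trans by blast
  have "0 < ?E"
    using gradient_flow.energy1_bounded_below[OF assms(1), of "\<phi> (n + 1)"] assms(4)
    by (simp add: eop_sav_regular_def shifted_energy1_def)
  have R: "(R (n + 1))\<^sup>2 = min Q ?E"
    using power2_min_sqrt[of Q ?E] \<open>0 \<le> Q\<close> \<open>0 < ?E\<close> assms(6)
    by (simp add: eop_sav_step_II_def eop_sav_s_def Q_def)
  show ?thesis
  proof (intro conjI allI impI)
    show "1/2 * ?b + (R (n + 1))\<^sup>2 \<le> 1/2 * ?a + \<bar>R n\<bar>\<^sup>2"
      unfolding R using min.cobounded1[of Q ?E] by (simp add: Q_def)
  next
    fix R' :: real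
    assume "1/2 * ?b + R'\<^sup>2 \<le> 1/2 * ?a + \<bar>R n\<bar>\<^sup>2"
    then have "R'\<^sup>2 \<le> Q"
      by (simp add: Q_def)
    \<comment> \<open>If the shifted energy is at most \<open>Q\<close>, the left side is zero.
      Otherwise \<open>R'\<^sup>2 \<le> Q\<close> lies below the energy, and \<open>Q\<close> is the
      closer of the two.\<close>
    then show "\<bar>\<bar>R (n + 1)\<bar>\<^sup>2 - ?E\<bar> \<le> \<bar>R'\<^sup>2 - ?E\<bar>"
      unfolding power2_abs R by (simp add: min_def)
  qed
qed

end
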